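(* Let $(X,d)$ be a complete metric space, let $\psi\colon[0,\infty)\to[0,\infty)$ be a function that is continuous at $0$ with $\psi(0)=0$, and let $T\colon X\to X$ be a mapping such that, for some $0\le\alpha<1$, $$\frac{d(Tx,Ty)+\psi(d(Tx,Ty))}{2}\le\alpha\,\big(d(x,y)\,\psi(d(x,y))\big)^{1/2}\quad\text{for all }x,y\in X.$$ Then $T$ is a Picard operator on $(X,d)$.
   Context: $X$ is a nonempty set. A self-mapping $T$ of a metric space $(X,d)$ is called a Picard operator if $T$ has a unique fixed point $u\in X$ and for every $x\in X$ the sequence of iterates $(T^n x)$ converges to $u$ in $(X,d)$. *)

theory Defs
  imports "HOL-Analysis.Abstract_Metric_Spaces" "HOL-Library.FuncSet"
begin

definition (in Metric_space) Picard_operator :: "('a \<Rightarrow> 'a) \<Rightarrow> bool" where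
  "Picard_operator T \<longleftrightarrow>
     T \<in> M \<rightarrow> M \<and>
     (\<exists>u\<in>M. T u = u \<and> (\<forall>v\<in>M. T v = v \<longrightarrow> v = u) \<and>
        (\<forall>x\<in>M. limitin mtopology (\<lambda>n. (T ^^ n) x) u sequentially))"

end

theory Submission
  imports Defs
begin

text \<open>Put \<open>S x y = sqrt (d x y * \<psi> (d x y))\<close>. By AM-GM the left-hand side of the hypothesis dominates both
  \<open>S (T x) (T y)\<close> and half of \<open>d (T x) (T y)\<close>, so \<open>S\<close>, and with it the distance, decays geometrically
  along orbits. Orbits are therefore Cauchy; continuity of \<open>\<psi>\<close> at \<open>0\<close> makes \<open>T\<close> continuous, so their
  limits are fixed points; and AM-GM once more yields uniqueness.\<close>

text \<open>Summing the steps as a geometric series bounds the distance from the \<open>n\<close>-th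
  term to every later one by \<open>C * r ^ n / (1 - r)\<close>, which tends to 0.\<close>

lemma (in Metric_space) MCauchy_geometric:
  fixes \<sigma> :: "nat \<Rightarrow> 'a"
  assumes M: "range \<sigma> \<subseteq> M" and r: "0 \<le> r" "r < 1"
    and step: "\<And>n. d (\<sigma> n) (\<sigma> (Suc n)) \<le> C * r ^ n"
  shows "MCauchy \<sigma>"
proof -
  have \<sigma>: "\<sigma> n \<in> M" for n using M by blast
  \<comment> \<open>At \<open>n = 0\<close> the step bound is \<open>C\<close> itself, since
    \<open>r ^ 0 = 1\<close>.\<close>
  have C: "0 \<le> C" using order_trans[OF nonneg step[of 0]] by simp
  \<comment> \<open>This is the partial geometric sum, multiplied by \<open>1 - r\<close> to avoid
    division. Keeping the subtracted power lets the induction close: the next step adds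
    \<open>C * r ^ (n + k) * (1 - r)\<close>, and the sum telescopes.\<close>
  have tel: "d (\<sigma> n) (\<sigma> (n + k)) * (1 - r) \<le> C * (r ^ n - r ^ (n + k))" for n k
  proof (induction k)
    case 0
    show ?case using \<sigma> by simp
  next
    case (Suc k)
    have "d (\<sigma> n) (\<sigma> (n + Suc k)) \<le> d (\<sigma> n) (\<sigma> (n + k)) + C * r ^ (n + k)"
      using triangle[of "\<sigma> n" "\<sigma> (n + k)" "\<sigma> (Suc (n + k))"] \<sigma> step[of "n + k"] by simp
    then have "d (\<sigma> n) (\<sigma> (n + Suc k)) * (1 - r)
        \<le> (d (\<sigma> n) (\<sigma> (n + k)) + C * r ^ (n + k)) * (1 - r)"
      using r by (intro mult_right_mono) auto
    also have "\<dots> \<le> C * (r ^ n - r ^ (n + k)) + C * r ^ (n + k) * (1 - r)"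
      using Suc by (simp add: distrib_right)
    also have "\<dots> = C * (r ^ n - r ^ (n + Suc k))"
      by (simp add: algebra_simps)
    finally show ?case .
  qed
  have tail: "d (\<sigma> n) (\<sigma> m) \<le> C * r ^ n / (1 - r)" if "n \<le> m" for n m
  proof -
    have "C * (r ^ n - r ^ m) \<le> C * r ^ n"
      using C r by (intro mult_left_mono) auto
    then show ?thesis
      using tel[of n "m - n"] that r by (simp add: pos_le_divide_eq)
  qed
  have "(\<lambda>n. C * r ^ n / (1 - r)) \<longlonglongrightarrow> C * 0 / (1 - r)"
    using r by (intro tendsto_intros LIMSEQ_power_zero) auto
  then have small: "\<forall>\<^sub>F n in sequentially. C * r ^ n / (1 - r) < \<epsilon>" if "0 < \<epsilon>" for \<epsilon>
    using that by (intro order_tendstoD) auto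
  show ?thesis
    unfolding MCauchy_def
  proof (intro conjI allI impI)
    fix \<epsilon> :: real assume "0 < \<epsilon>"
    then obtain N where N: "\<And>n. N \<le> n \<Longrightarrow> C * r ^ n / (1 - r) < \<epsilon>"
      using small unfolding eventually_sequentially by blast
    have "d (\<sigma> n) (\<sigma> m) < \<epsilon>" if "N \<le> n" "N \<le> m" for n m
    proof (cases "n \<le> m")
      case True
      then show ?thesis using tail[of n m] N[of n] that by simp
    next
      case False
      then show ?thesis using tail[of m n] N[of m] that by (simp add: commute[of "\<sigma> n"])
    qed
    then show "\<exists>N. \<forall>n n'. N \<le> n \<longrightarrow> N \<le> n' \<longrightarrow> d (\<sigma> n) (\<sigma> n') < \<epsilon>" by blast
  qed (use M in blast)
qed

theorem corollary2p11:
  fixes X :: "'a set" and d :: "'a \<Rightarrow> 'a \<Rightarrow> real"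
    and \<psi> :: "real \<Rightarrow> real" and T :: "'a \<Rightarrow> 'a" and \<alpha> :: real
  assumes "X \<noteq> {}"
    and "Metric_space X d"
    and "Metric_space.mcomplete X d"
    and "\<psi> \<in> {0..} \<rightarrow> {0..}"
    and "continuous (at 0 within {0..}) \<psi>"
    and "\<psi> 0 = 0"
    and "T \<in> X \<rightarrow> X"
    and "0 \<le> \<alpha>" and "\<alpha> < 1"
    and "\<And>x y. x \<in> X \<Longrightarrow> y \<in> X \<Longrightarrow>
           (d (T x) (T y) + \<psi> (d (T x) (T y))) / 2 \<le> \<alpha> * sqrt (d x y * \<psi> (d x y))"
  shows "Metric_space.Picard_operator X d T"
proof -
  interpret Metric_space X d by fact
  define S where "S x y = sqrt (d x y * \<psi> (d x y))" for x y
  have TX: "T x \<in> X" if "x \<in> X" for x using assms(7) that by auto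
  have \<psi>0: "0 \<le> \<psi> (d x y)" for x y using assms(4) by (simp add: Pi_iff)
  have amgm: "S x y \<le> (d x y + \<psi> (d x y)) / 2" for x y
    unfolding S_def by (rule arith_geo_mean_sqrt) (auto simp: \<psi>0)
  have contr: "(d (T x) (T y) + \<psi> (d (T x) (T y))) / 2 \<le> \<alpha> * S x y" if "x \<in> X" "y \<in> X" for x y
    unfolding S_def using assms(10) that by blast
  have S_step: "S (T x) (T y) \<le> \<alpha> * S x y" if "x \<in> X" "y \<in> X" for x y
    using amgm contr that order_trans by blast
  have d_step: "d (T x) (T y) \<le> 2 * \<alpha> * S x y" if "x \<in> X" "y \<in> X" for x y
    using contr[OF that] \<psi>0[of "T x" "T y"] by simp
  have unique: "u = v" if "u \<in> X" "v \<in> X" "T u = u" "T v = v" for u v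
  proof -
    \<comment> \<open>At two fixed points the left-hand side of the contraction is the arithmetic
      mean \<open>?m\<close> itself, and the right-hand side is at most
      \<open>\<alpha> * ?m\<close>. As \<alpha> < 1, both nonnegative summands of \<open>?m\<close>
      must vanish.\<close>
    let ?m = "(d u v + \<psi> (d u v)) / 2"
    have "?m \<le> \<alpha> * ?m"
      using contr[of u v] mult_left_mono[OF amgm assms(8), of u v] that by simp
    then have "(1 - \<alpha>) * ?m \<le> 0" by (simp add: algebra_simps)
    then have "?m \<le> 0" using assms(9) by (simp add: mult_le_0_iff)
    then have "d u v \<le> 0" using \<psi>0[of u v] by simp
    then have "d u v = 0" by (simp add: order_antisym)
    then show ?thesis using that by simp
  qed
  have orbit: "\<exists>u\<in>X. T u = u \<and> limitin mtopology (\<lambda>n. (T ^^ n) x) u sequentially" if x: "x \<in> X" for x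
  proof -
    define \<sigma> where "\<sigma> n = (T ^^ n) x" for n
    have \<sigma>_Suc: "\<sigma> (Suc n) = T (\<sigma> n)" for n by (simp add: \<sigma>_def)
    have \<sigma>: "\<sigma> n \<in> X" for n
      by (induction n) (simp_all add: \<sigma>_Suc TX, simp add: \<sigma>_def x)
    have S_decay: "S (\<sigma> n) (\<sigma> (Suc n)) \<le> \<alpha> ^ n * S (\<sigma> 0) (\<sigma> 1)" for n
    proof (induction n)
      case (Suc n)
      show ?case
        using S_step[OF \<sigma> \<sigma>, of n "Suc n"] mult_left_mono[OF Suc assms(8)] by (simp add: \<sigma>_Suc mult.assoc)
    qed simp
    \<comment> \<open>The first summand covers \<open>n = 0\<close>, where \<open>d_step\<close> has
      no preceding pair to start from. For \<open>n = Suc m\<close> the second suffices: the factor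
      \<alpha> in \<open>d_step\<close> raises \<open>\<alpha> ^ m\<close> to
      \<open>\<alpha> ^ n\<close>, with no division by \<alpha>, which may be 0.\<close>
    define C where "C = d (\<sigma> 0) (\<sigma> 1) + 2 * S (\<sigma> 0) (\<sigma> 1)"
    have "d (\<sigma> n) (\<sigma> (Suc n)) \<le> C * \<alpha> ^ n" for n
    proof (cases n)
      case 0
      then show ?thesis by (simp add: C_def S_def \<psi>0)
    next
      case (Suc m)
      have "d (\<sigma> n) (\<sigma> (Suc n)) \<le> 2 * \<alpha> * S (\<sigma> m) (\<sigma> (Suc m))"
        using d_step[OF \<sigma> \<sigma>, of m "Suc m"] by (simp add: Suc \<sigma>_Suc)
      also have "\<dots> \<le> 2 * \<alpha> * (\<alpha> ^ m * S (\<sigma> 0) (\<sigma> 1))"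
        using assms(8) by (intro mult_left_mono S_decay) auto
      also have "\<dots> = 2 * S (\<sigma> 0) (\<sigma> 1) * \<alpha> ^ n" by (simp add: Suc)
      also have "\<dots> \<le> C * \<alpha> ^ n"
        unfolding C_def using assms(8) by (intro mult_right_mono) auto
      finally show ?thesis .
    qed
    then have "MCauchy \<sigma>"
      using \<sigma> assms(8,9) by (intro MCauchy_geometric[of \<sigma> \<alpha> C]) auto
    then obtain u where u: "limitin mtopology \<sigma> u sequentially"
      using assms(3) unfolding mcomplete_def by blast
    then have uX: "u \<in> X" and lim: "(\<lambda>n. d (\<sigma> n) u) \<longlonglongrightarrow> 0"
      by (auto simp: limitin_metric_dist_null)
    \<comment> \<open>Continuity at 0 enters here: the distances to the limit approach 0 within
      \<open>{0..}\<close>, so both factors under the root in \<open>S (\<sigma> n) u\<close> tend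
      to 0.\<close>
    have "(\<lambda>n. \<psi> (d (\<sigma> n) u)) \<longlonglongrightarrow> \<psi> 0"
      using continuous_within_tendsto_compose[OF assms(5) _ lim] by simp
    then have "(\<lambda>n. 2 * \<alpha> * S (\<sigma> n) u) \<longlonglongrightarrow> 2 * \<alpha> * sqrt (0 * \<psi> 0)"
      unfolding S_def by (intro tendsto_intros lim)
    then have "(\<lambda>n. 2 * \<alpha> * S (\<sigma> n) u) \<longlonglongrightarrow> 0" by simp
    \<comment> \<open>Squeezed between 0 and the bound of \<open>d_step\<close> for the pair
      \<open>\<sigma> n\<close>, \<open>u\<close>. The shifted orbit thus converges to
      \<open>T u\<close> as well as to \<open>u\<close>.\<close>
    then have "(\<lambda>n. d (\<sigma> (Suc n)) (T u)) \<longlonglongrightarrow> 0"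
      by (rule tendsto_sandwich[OF _ _ tendsto_const, rotated 2])
        (auto simp: \<sigma>_Suc intro!: always_eventually d_step[OF \<sigma> uX])
    then have "limitin mtopology (\<lambda>n. \<sigma> (Suc n)) (T u) sequentially"
      using \<sigma> TX[OF uX] by (simp add: limitin_metric_dist_null)
    moreover have "limitin mtopology (\<lambda>n. \<sigma> (Suc n)) u sequentially"
      using u limitin_sequentially_offset[of mtopology \<sigma> u 1] by simp
    ultimately have "T u = u"
      by (rule limitin_metric_unique) simp
    then show ?thesis using u uX unfolding \<sigma>_def by blast
  qed
  obtain x where "x \<in> X" using assms(1) by blast
  then obtain u where u: "u \<in> X" "T u = u" using orbit by blast
  \<comment> \<open>A priori the limit supplied by \<open>orbit\<close> depends on \<open>y\<close>;
    being a fixed point, it coincides with \<open>u\<close> by uniqueness.\<close>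
  moreover have "limitin mtopology (\<lambda>n. (T ^^ n) y) u sequentially" if "y \<in> X" for y
    using orbit[OF that] unique[OF _ u(1) _ u(2)] by blast
  ultimately show ?thesis
    unfolding Picard_operator_def using assms(7) unique[OF _ u(1) _ u(2)] by blast
qed

end
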